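(* The twisted descendants of $\mathbb{P}^r$ can be reconstructed from the usual gravitational descendants, and thus from the Gromov–Witten invariants. That is, for all $r$, $d>0$ and $n>0$, every twisted descendant $\langle\prod_{i=1}^n\tau_{u_i}^{m_i}(c_i)\rangle_d$ is computed, by finitely many applications of the recursion relation (R), from gravitational descendants (twisted descendants with all $m_i=0$) of degree $d$; and hence, using further the divisor equation (D) and the topological recursion relation (T) finitely many times, from the genus-$0$ Gromov–Witten invariants of $\mathbb{P}^r$ (gravitational descendants with all $u_i=0$).
   Context: Work over $\mathbb{C}$. $\overline{M}_{0,n}(\mathbb{P}^r,d)$ is the moduli space of Kontsevich stable maps of genus $0$ and degree $d$ to $\mathbb{P}^r$ with marks $[n]=\{1,\dots,n\}$. $\eta_i:=c_1(\nu_i^{*}\mathcal{O}(1))$ with $\nu_i$ the evaluation map of mark $i$; $\psi_i:=c_1(\sigma_i^{*}\omega_\pi)$, where $\pi$ is the tautological family forgetting the last mark, $\sigma_i$ its section corresponding to mark $i$, and $\omega_\pi$ its relative dualising sheaf. For $d>0$, $\beta_i$ is the sum of all boundary divisors $(A,0\mid B,d)$ with $A\cup B=[n]$, $i\in A$, $\sharp A\ge2$ (general point: two irreducible components, a contracted one carrying the marks $A$ and one of degree $d$ carrying the marks $B$), and $\overline{\psi}_i:=\psi_i-\beta_i$. Twisted descendants ($d>0$): $\langle\prod_{i=1}^n\tau_{u_i}^{m_i}(c_i)\rangle_d:=\int\prod_{i}\psi_i^{u_i}\overline{\psi}_i^{\,m_i}\eta_i^{c_i}\cap[\overline{M}_{0,n}(\mathbb{P}^r,d)]$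 (zero if the class is not of top degree). They are symmetric under relabelling of marks. Gravitational descendants: $\langle\prod_i\tau_{u_i}(c_i)\rangle_d:=\int\prod_i\psi_i^{u_i}\eta_i^{c_i}\cap[\overline{M}_{0,n}(\mathbb{P}^r,d)]$ for $d\ge0$. (R) If $m_1>0$ and $d>0$: $$\Bigl\langle\prod_{i=1}^{n}\tau_{u_i}^{m_i}(c_i)\Bigr\rangle_d=\Bigl\langle\tau_{u_1+1}^{m_1-1}(c_1)\prod_{i=2}^{n}\tau_{u_i}^{m_i}(c_i)\Bigr\rangle_d-\sum\Bigl\langle\prod_{i\in A}\tau_{u_i}\cdot\tau_0\Bigr\rangle\Bigl\langle\tau_0^{\mathbf{m}-1}(\mathbf{c})\prod_{i\in B}\tau_{u_i}^{m_i}(c_i)\Bigr\rangle_d,$$ the sum over partitions $A\cup B=[n]$ with $1\in A$, $\sharp A\ge2$, where $\mathbf{m}=\sum_{i\in A}m_i$, $\mathbf{c}=\sum_{i\in A}c_i$; the first factor is $\int\prod_{i\in A}\psi_i^{u_i}$ over the Knudsen–Mumford space $\overline{M}_{0,A\cup\{x_A\}}$, equal to $(\sharp A-2)!/\prod_{i\in A}u_i!$ if $\sum_{i\in A}u_i=\sharp A-2$ and $0$ otherwise; the last factor has marks $B\cup\{x_B\}$, with $\tau_0^{\mathbf{m}-1}(\mathbf{c})$ attached to $x_B$. (D) $\langle\prod_{i=1}^n\tau_{u_i}(c_i)\cdot\tau_0(1)\rangle_d=d\,\langle\prod_{i=1}^n\tau_{u_i}(c_i)\rangle_d+\sum_{j=1}^n\langle\prod_{i=1}^n\tau_{u_i-\delta_{ij}}(c_i+\delta_{ij})\rangle_d$,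 terms with a negative exponent on a psi class being $0$. (T) If $n\ge3$, $u_1\ge1$ and $j,k\ne1$ are two distinct fixed marks: $\langle\prod_{i=1}^n\tau_{u_i}(c_i)\rangle_d=\sum\langle\tau_{u_1-1}(c_1)\prod_{i\in A,\,i\neq1}\tau_{u_i}(c_i)\,\tau_0(e)\rangle_{d_A}\langle\tau_0(r-e)\prod_{i\in B}\tau_{u_i}(c_i)\rangle_{d_B}$, summed over stable splittings $A\cup B=[n]$, $d_A+d_B=d$ with $1\in A$ and $j,k\in B$, and over $e=0,\dots,r$. *)

theory Defs
  imports Complex_Main "HOL-Library.Multiset"
begin

(* The insertion tau_u^m(c); a bracket <prod_i tau_{u_i}^{m_i}(c_i)>_d is given by d and the list
   of its insertions. Marks are numbered from 0, so mark i of [n] is list position i - 1. *)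

datatype insertion = Tau (psi_exp: nat) (psibar_exp: nat) (eta_exp: nat)

type_synonym bracket = "nat \<times> insertion list"

(* Whether the space of stable maps of degree d with n marks is defined. *)
definition stable :: "nat \<Rightarrow> nat \<Rightarrow> bool" where
  "stable d n \<longleftrightarrow> 0 < d \<or> 3 \<le> n"

definition gravitational :: "bracket \<Rightarrow> bool" where
  "gravitational = (\<lambda>(d, xs). stable d (length xs) \<and> (\<forall>x \<in> set xs. psibar_exp x = 0))"

definition gromov_witten :: "bracket \<Rightarrow> bool" where
  "gromov_witten = (\<lambda>(d, xs). gravitational (d, xs) \<and> (\<forall>x \<in> set xs. psi_exp x = 0))"


(* The classes on the moduli spaces, and integration against their fundamental classes. The
   spaces are not constructed; a single ring 'a serves for all of them (e.g. the product of their
   Chow rings). Arguments: the degree d, the number n of marks, then the mark i < n;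
   bdry X d n A is the boundary divisor (A,0 | [n]-A,d). The KM fields belong to the
   Knudsen-Mumford space of n-pointed rational curves. *)

record 'a moduli_classes =
  integ :: "nat \<Rightarrow> nat \<Rightarrow> 'a \<Rightarrow> rat"
  psi :: "nat \<Rightarrow> nat \<Rightarrow> nat \<Rightarrow> 'a"
  eta :: "nat \<Rightarrow> nat \<Rightarrow> nat \<Rightarrow> 'a"
  bdry :: "nat \<Rightarrow> nat \<Rightarrow> nat set \<Rightarrow> 'a"
  integ_KM :: "nat \<Rightarrow> 'a \<Rightarrow> rat"
  psi_KM :: "nat \<Rightarrow> nat \<Rightarrow> 'a"

definition beta :: "'a::comm_ring_1 moduli_classes \<Rightarrow> nat \<Rightarrow> nat \<Rightarrow> nat \<Rightarrow> 'a" where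
  "beta X d n i = (\<Sum>A \<in> {A. A \<subseteq> {..<n} \<and> i \<in> A \<and> 2 \<le> card A}. bdry X d n A)"

definition psibar :: "'a::comm_ring_1 moduli_classes \<Rightarrow> nat \<Rightarrow> nat \<Rightarrow> nat \<Rightarrow> 'a" where
  "psibar X d n i = psi X d n i - beta X d n i"

(* The space of stable maps to P^r has dimension r*d + r + d + n - 3. In degree 0 only brackets
   without psibar classes are ever used. *)
definition twisted :: "nat \<Rightarrow> 'a::comm_ring_1 moduli_classes \<Rightarrow> nat \<Rightarrow> insertion list \<Rightarrow> rat" where
  "twisted r X d xs =
     (let n = length xs in
      if (\<Sum>i<n. psi_exp (xs!i) + psibar_exp (xs!i) + eta_exp (xs!i)) + 3 = r * d + r + d + n
      then integ X d n (\<Prod>i<n. psi X d n i ^ psi_exp (xs!i) * psibar X d n i ^ psibar_exp (xs!i)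
                                * eta X d n i ^ eta_exp (xs!i))
      else 0)"

(* The factor <prod_{i in A} tau_{u_i} . tau_0>, with us the exponents over A and x_A the
   last mark. *)
definition KM_bracket :: "'a::comm_ring_1 moduli_classes \<Rightarrow> nat list \<Rightarrow> rat" where
  "KM_bracket X us =
     (let k = length us in integ_KM X (k + 1) (\<Prod>i<k. psi_KM X (k + 1) i ^ (us!i)))"

definition KM_number :: "nat list \<Rightarrow> rat" where
  "KM_number us =
     (if sum_list us = length us - 2 then fact (length us - 2) / (\<Prod>u\<leftarrow>us. fact u) else 0)"

definition KM_formula :: "'a::comm_ring_1 moduli_classes \<Rightarrow> bool" where
  "KM_formula X \<longleftrightarrow> (\<forall>us. 2 \<le> length us \<longrightarrow> KM_bracket X us = KM_number us)"

definition relabelling_invariant :: "nat \<Rightarrow> 'a::comm_ring_1 moduli_classes \<Rightarrow> bool" where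
  "relabelling_invariant r X \<longleftrightarrow>
     (\<forall>d xs ys. 0 < d \<or> gravitational (d, xs) \<longrightarrow> mset xs = mset ys \<longrightarrow>
        twisted r X d xs = twisted r X d ys)"


(* The index A of a summand in (R); B is its complement. *)
definition R_splittings :: "nat \<Rightarrow> nat set set" where
  "R_splittings n = {A. A \<subseteq> {..<n} \<and> 0 \<in> A \<and> 2 \<le> card A}"

definition R_psi_exps :: "insertion list \<Rightarrow> nat set \<Rightarrow> nat list" where
  "R_psi_exps xs A = map psi_exp (nths xs A)"

(* Marks of the last factor of (R): x_B, followed by B. *)
definition R_remaining :: "insertion list \<Rightarrow> nat set \<Rightarrow> insertion list" where
  "R_remaining xs A =
     Tau 0 ((\<Sum>i\<in>A. psibar_exp (xs!i)) - 1) (\<Sum>i\<in>A. eta_exp (xs!i)) # nths xs (- A)"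

definition relation_R :: "nat \<Rightarrow> 'a::comm_ring_1 moduli_classes \<Rightarrow> bool" where
  "relation_R r X \<longleftrightarrow>
     (\<forall>d u m c ys. 0 < d \<longrightarrow> 0 < m \<longrightarrow>
        (let xs = Tau u m c # ys in
         twisted r X d xs =
           twisted r X d (Tau (u + 1) (m - 1) c # ys)
           - (\<Sum>A \<in> R_splittings (length xs).
                KM_bracket X (R_psi_exps xs A) * twisted r X d (R_remaining xs A))))"

(* The j-th summand of (D), defined when psi_exp (xs!j) > 0. *)
definition D_shift :: "insertion list \<Rightarrow> nat \<Rightarrow> insertion list" where
  "D_shift xs j = xs[j := Tau (psi_exp (xs!j) - 1) 0 (eta_exp (xs!j) + 1)]"

definition D_indices :: "insertion list \<Rightarrow> nat set" where
  "D_indices xs = {j. j < length xs \<and> 0 < psi_exp (xs!j)}"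

definition relation_D :: "nat \<Rightarrow> 'a::comm_ring_1 moduli_classes \<Rightarrow> bool" where
  "relation_D r X \<longleftrightarrow>
     (\<forall>d xs. gravitational (d, xs) \<longrightarrow>
        twisted r X d (xs @ [Tau 0 0 1]) =
          of_nat d * twisted r X d xs + (\<Sum>j \<in> D_indices xs. twisted r X d (D_shift xs j)))"

(* Triples (A, d_A, e); B and d_B are the complements, both parts having one extra mark. *)
definition T_splittings :: "nat \<Rightarrow> nat \<Rightarrow> nat \<Rightarrow> nat \<Rightarrow> nat \<Rightarrow> (nat set \<times> nat \<times> nat) set" where
  "T_splittings r d n j k =
     {(A, dA, e). A \<subseteq> {..<n} \<and> 0 \<in> A \<and> j \<notin> A \<and> k \<notin> A \<and> dA \<le> d \<and> e \<le> r \<and>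
        stable dA (card A + 1) \<and> stable (d - dA) (n - card A + 1)}"

definition T_left :: "insertion list \<Rightarrow> nat set \<Rightarrow> nat \<Rightarrow> insertion list" where
  "T_left xs A e =
     Tau (psi_exp (xs!0) - 1) 0 (eta_exp (xs!0)) # nths xs (A - {0}) @ [Tau 0 0 e]"

definition T_right :: "nat \<Rightarrow> insertion list \<Rightarrow> nat set \<Rightarrow> nat \<Rightarrow> insertion list" where
  "T_right r xs A e = Tau 0 0 (r - e) # nths xs (- A)"

definition T_applicable :: "nat \<Rightarrow> insertion list \<Rightarrow> nat \<Rightarrow> nat \<Rightarrow> bool" where
  "T_applicable d xs j k \<longleftrightarrow>
     gravitational (d, xs) \<and> 3 \<le> length xs \<and> 1 \<le> psi_exp (xs!0) \<and>
     j \<in> {1..<length xs} \<and> k \<in> {1..<length xs} \<and> j \<noteq> k"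

definition relation_T :: "nat \<Rightarrow> 'a::comm_ring_1 moduli_classes \<Rightarrow> bool" where
  "relation_T r X \<longleftrightarrow>
     (\<forall>d xs j k. T_applicable d xs j k \<longrightarrow>
        twisted r X d xs =
          (\<Sum>(A, dA, e) \<in> T_splittings r d (length xs) j k.
             twisted r X dA (T_left xs A e) * twisted r X (d - dA) (T_right r xs A e)))"


(* Formal polynomial expressions in brackets. A relation is applied by replacing one occurrence
   of a bracket in such an expression by the expression which the relation gives for it. *)

datatype expr = Const rat | Desc nat "insertion list" | Sum "expr multiset" | Prod expr expr

primrec brackets :: "expr \<Rightarrow> bracket set" where
  "brackets (Const q) = {}"
| "brackets (Desc d xs) = {(d, xs)}"
| "brackets (Sum M) = \<Union> (set_mset (image_mset brackets M))"
| "brackets (Prod a b) = brackets a \<union> brackets b"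

primrec eval :: "(nat \<Rightarrow> insertion list \<Rightarrow> rat) \<Rightarrow> expr \<Rightarrow> rat" where
  "eval V (Const q) = q"
| "eval V (Desc d xs) = V d xs"
| "eval V (Sum M) = sum_mset (image_mset (eval V) M)"
| "eval V (Prod a b) = eval V a * eval V b"

inductive rewrite :: "(nat \<Rightarrow> insertion list \<Rightarrow> expr \<Rightarrow> bool) \<Rightarrow> expr \<Rightarrow> expr \<Rightarrow> bool"
  for rule where
  here: "rule d xs e \<Longrightarrow> rewrite rule (Desc d xs) e"
| summand: "rewrite rule e e' \<Longrightarrow> rewrite rule (Sum (add_mset e M)) (Sum (add_mset e' M))"
| left: "rewrite rule a a' \<Longrightarrow> rewrite rule (Prod a b) (Prod a' b)"
| right: "rewrite rule b b' \<Longrightarrow> rewrite rule (Prod a b) (Prod a b')"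

(* A bracket does not depend on the order of its marks, whereas the relations single out mark 0;
   hence the relabelling rules. *)
inductive rule_R :: "nat \<Rightarrow> insertion list \<Rightarrow> expr \<Rightarrow> bool" where
  relabel: "mset xs = mset ys \<Longrightarrow> rule_R d xs (Desc d ys)"
| recursion: "0 < d \<Longrightarrow> 0 < m \<Longrightarrow> xs = Tau u m c # ys \<Longrightarrow>
    rule_R d xs
      (Sum (add_mset (Desc d (Tau (u + 1) (m - 1) c # ys))
        {# Prod (Const (- KM_number (R_psi_exps xs A))) (Desc d (R_remaining xs A)).
           A \<in># mset_set (R_splittings (length xs)) #}))"

(* (D) may be used in both directions: to remove tau_0(1), or solved for the bracket
   multiplied by d. *)
inductive rule_DT :: "nat \<Rightarrow> nat \<Rightarrow> insertion list \<Rightarrow> expr \<Rightarrow> bool" for r where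
  relabel: "mset xs = mset ys \<Longrightarrow> rule_DT r d xs (Desc d ys)"
| divisor: "gravitational (d, xs) \<Longrightarrow>
    rule_DT r d (xs @ [Tau 0 0 1])
      (Sum (add_mset (Prod (Const (of_nat d)) (Desc d xs))
        {# Desc d (D_shift xs j). j \<in># mset_set (D_indices xs) #}))"
| divisor_solved: "gravitational (d, xs) \<Longrightarrow> 0 < d \<Longrightarrow>
    rule_DT r d xs
      (Prod (Const (1 / of_nat d))
        (Sum (add_mset (Desc d (xs @ [Tau 0 0 1]))
          {# Prod (Const (- 1)) (Desc d (D_shift xs j)). j \<in># mset_set (D_indices xs) #})))"
| topological: "T_applicable d xs j k \<Longrightarrow>
    rule_DT r d xs
      (Sum {# case t of (A, dA, e) \<Rightarrow>
                Prod (Desc dA (T_left xs A e)) (Desc (d - dA) (T_right r xs A e)).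
              t \<in># mset_set (T_splittings r d (length xs) j k) #})"

end

theory Submission
  imports Defs
begin

text \<open>
  The relations hold by assumption, so the point is that applying them in a suitable direction
  terminates. Every bracket on the right-hand side of (R) has exactly one psibar class
  fewer than the left-hand side: the sum over $A$ merges the psibar exponents of the marks in $A$
  into $\mathbf{m} - 1$. Induction on the total psibar exponent therefore removes all psibar classes
  without changing the degree.

  For a gravitational descendant with some psi class left, (T) with the distinguished mark carrying
  that class takes one psi class away and distributes the remaining ones over the two factors, so
  that both factors have fewer psi classes; this also covers degree $0$, where stability provides
  the three marks that (T) needs. In positive degree there may be only one or two marks. Then (D),
  solved for the bracket multiplied by $d$, adds a mark $\tau_0(1)$ at the price of correction terms
  that have one psi class fewer. Hence the total psi exponent, followed lexicographically by the
  number of marks missing to three, decreases in every step.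

  Since the relations produce sums of products of brackets, the induction hypotheses are carried
  from brackets to expressions by \<open>reducible_if_brackets_reducible\<close>.
\<close>

section \<open>Reduction of expressions\<close>

text \<open>Rewriting into good brackets and preservation of the value are kept together: the rules are
  sound only for brackets subject to side conditions (such as stability), so that soundness is not
  available for an arbitrary rewrite sequence.\<close>

definition reducible ::
  "(nat \<Rightarrow> insertion list \<Rightarrow> expr \<Rightarrow> bool) \<Rightarrow> (nat \<Rightarrow> insertion list \<Rightarrow> rat) \<Rightarrow> (bracket \<Rightarrow> bool)
     \<Rightarrow> expr \<Rightarrow> bool" where
  "reducible rule V good e \<longleftrightarrow>
     (\<exists>e'. (rewrite rule)\<^sup>*\<^sup>* e e' \<and> (\<forall>b \<in> brackets e'. good b) \<and> eval V e = eval V e')"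

lemma rewrites_summand:
  assumes "(rewrite rule)\<^sup>*\<^sup>* e e'"
  shows "(rewrite rule)\<^sup>*\<^sup>* (Sum (add_mset e M)) (Sum (add_mset e' M))"
  using assms by induction (auto intro: rewrite.summand rtranclp.rtrancl_into_rtrancl)

lemma rewrites_left:
  assumes "(rewrite rule)\<^sup>*\<^sup>* a a'"
  shows "(rewrite rule)\<^sup>*\<^sup>* (Prod a b) (Prod a' b)"
  using assms by induction (auto intro: rewrite.left rtranclp.rtrancl_into_rtrancl)

lemma rewrites_right:
  assumes "(rewrite rule)\<^sup>*\<^sup>* b b'"
  shows "(rewrite rule)\<^sup>*\<^sup>* (Prod a b) (Prod a b')"
  using assms by induction (auto intro: rewrite.right rtranclp.rtrancl_into_rtrancl)

lemma reducible_good: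
  assumes "\<forall>b \<in> brackets e. good b"
  shows "reducible rule V good e"
  using assms unfolding reducible_def by blast

lemma reducible_Prod:
  assumes "reducible rule V good a" and "reducible rule V good b"
  shows "reducible rule V good (Prod a b)"
proof -
  obtain a' b' where
    a': "(rewrite rule)\<^sup>*\<^sup>* a a'" "\<forall>x \<in> brackets a'. good x" "eval V a = eval V a'" and
    b': "(rewrite rule)\<^sup>*\<^sup>* b b'" "\<forall>x \<in> brackets b'. good x" "eval V b = eval V b'"
    using assms unfolding reducible_def by blast
  have "(rewrite rule)\<^sup>*\<^sup>* (Prod a b) (Prod a' b')"
    using rewrites_left[OF a'(1)] rewrites_right[OF b'(1)] by (rule rtranclp_trans)
  then show ?thesis
    unfolding reducible_def using a' b' by (intro exI[of _ "Prod a' b'"]) auto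
qed

lemma reducible_Sum:
  assumes "\<forall>e \<in># M. reducible rule V good e"
  shows "reducible rule V good (Sum M)"
proof -
  (* The unprocessed or already rewritten summands N stay beside M throughout the induction. *)
  have "\<exists>M'. (\<forall>N. (rewrite rule)\<^sup>*\<^sup>* (Sum (M + N)) (Sum (M' + N))) \<and>
             (\<forall>b \<in> brackets (Sum M'). good b) \<and> eval V (Sum M) = eval V (Sum M')"
    using assms
  proof (induction M)
    case empty
    then show ?case
      by (intro exI[of _ "{#}"]) auto
  next
    case (add e M)
    obtain M' where M': "\<And>N. (rewrite rule)\<^sup>*\<^sup>* (Sum (M + N)) (Sum (M' + N))"
      "\<forall>b \<in> brackets (Sum M'). good b" "eval V (Sum M) = eval V (Sum M')"
      using add by auto
    obtain e' where e': "(rewrite rule)\<^sup>*\<^sup>* e e'" "\<forall>b \<in> brackets e'. good b" "eval V e = eval V e'"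
      using add.prems unfolding reducible_def by auto
    have "(rewrite rule)\<^sup>*\<^sup>* (Sum (add_mset e M + N)) (Sum (add_mset e' M' + N))" for N
      using rewrites_summand[OF e'(1), of "M + N"] M'(1)[of "add_mset e' N"]
      by (auto intro: rtranclp_trans)
    then show ?case
      using M'(2,3) e'(2,3) by (intro exI[of _ "add_mset e' M'"]) auto
  qed
  then obtain M' where M': "\<And>N. (rewrite rule)\<^sup>*\<^sup>* (Sum (M + N)) (Sum (M' + N))"
    "\<forall>b \<in> brackets (Sum M'). good b" "eval V (Sum M) = eval V (Sum M')"
    by blast
  show ?thesis
    unfolding reducible_def using M'(1)[of "{#}"] M'(2,3) by (intro exI[of _ "Sum M'"]) auto
qed

lemma reducible_if_brackets_reducible:
  assumes "\<forall>(d, xs) \<in> brackets e. reducible rule V good (Desc d xs)"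
  shows "reducible rule V good e"
  using assms
proof (induction e)
  case (Const q)
  show ?case by (rule reducible_good) simp
next
  case (Desc d xs)
  then show ?case by simp
next
  case (Sum M)
  then show ?case by (intro reducible_Sum) auto
next
  case (Prod a b)
  then show ?case by (intro reducible_Prod) auto
qed

lemma reducible_expand:
  assumes "(rewrite rule)\<^sup>*\<^sup>* e e'" and "eval V e = eval V e'"
    and "\<forall>(d, xs) \<in> brackets e'. reducible rule V good (Desc d xs)"
  shows "reducible rule V good e"
proof -
  obtain e'' where "(rewrite rule)\<^sup>*\<^sup>* e' e''" "\<forall>b \<in> brackets e''. good b" "eval V e' = eval V e''"
    using reducible_if_brackets_reducible[OF assms(3)] unfolding reducible_def by blast
  then show ?thesis
    unfolding reducible_def using assms(1,2) by (metis rtranclp_trans)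
qed

lemma eval_Sum_image_mset_set:
  "eval V (Sum (image_mset f (mset_set S))) = (\<Sum>s\<in>S. eval V (f s))"
  by (simp add: sum_unfold_sum_mset image_mset.compositionality comp_def)

section \<open>Sums over the two parts of a splitting\<close>

lemma sum_list_map_nths:
  "sum_list (map f (nths xs I)) = (\<Sum>i \<in> I \<inter> {..<length xs}. f (xs ! i))"
  for f :: "'b \<Rightarrow> 'c::comm_monoid_add"
proof (induction xs rule: rev_induct)
  case Nil
  then show ?case by simp
next
  case (snoc x xs)
  have "(\<Sum>i \<in> I \<inter> {..<length xs}. f ((xs @ [x]) ! i)) = (\<Sum>i \<in> I \<inter> {..<length xs}. f (xs ! i))"
    by (intro sum.cong) (auto simp: nth_append)
  moreover have "I \<inter> {..<length (xs @ [x])} =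
      (if length xs \<in> I then insert (length xs) (I \<inter> {..<length xs}) else I \<inter> {..<length xs})"
    by (auto simp: less_Suc_eq)
  ultimately show ?case
    using snoc by (auto simp: nths_append add.commute)
qed

lemma sum_list_map_nths_complement:
  fixes f :: "'b \<Rightarrow> 'c::comm_monoid_add"
  assumes "A \<subseteq> {..<length xs}"
  shows "(\<Sum>i\<in>A. f (xs ! i)) + sum_list (map f (nths xs (- A))) = sum_list (map f xs)"
proof -
  have "sum_list (map f xs) = (\<Sum>i<length xs. f (xs ! i))"
    by (simp add: sum_list_sum_nth atLeast0LessThan)
  also have "\<dots> = (\<Sum>i\<in>A. f (xs ! i)) + (\<Sum>i\<in>{..<length xs} - A. f (xs ! i))"
    using sum.subset_diff[OF assms finite_lessThan, of "\<lambda>i. f (xs ! i)"]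
    by (simp add: add.commute)
  also have "{..<length xs} - A = - A \<inter> {..<length xs}"
    by auto
  finally show ?thesis
    by (simp add: sum_list_map_nths)
qed

lemma length_nths_subset:
  assumes "A \<subseteq> {..<length xs}"
  shows "length (nths xs A) = card A"
proof -
  have "{i. i < length xs \<and> i \<in> A} = A"
    using assms by auto
  then show ?thesis
    by (simp add: length_nths)
qed

lemma length_nths_complement:
  assumes "A \<subseteq> {..<length xs}"
  shows "length (nths xs (- A)) = length xs - card A"
proof -
  have "{i. i < length xs \<and> i \<in> - A} = {..<length xs} - A"
    by auto
  then show ?thesis
    using assms by (simp add: length_nths card_Diff_subset finite_subset)
qed

lemma mset_move_to_front:
  assumes "x \<in> set xs"
  obtains ys where "mset xs = mset (x # ys)"
  using assms by (metis ex_mset insert_DiffM mset.simps(2) set_mset_mset)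

section \<open>Removing the psibar classes\<close>

abbreviation total_psibar :: "insertion list \<Rightarrow> nat" where
  "total_psibar xs \<equiv> sum_list (map psibar_exp xs)"

lemma finite_R_splittings: "finite (R_splittings n)"
  by (rule finite_subset[of _ "Pow {..<n}"]) (auto simp: R_splittings_def)

text \<open>Positivity of the exponent at mark $0$ makes $\mathbf{m} \ge 1$, so that $\mathbf{m} - 1$ is a
  true subtraction.\<close>

lemma total_psibar_R_remaining:
  assumes "A \<in> R_splittings (length xs)" and "0 < psibar_exp (xs ! 0)"
  shows "total_psibar (R_remaining xs A) + 1 = total_psibar xs"
proof -
  have A: "A \<subseteq> {..<length xs}" "0 \<in> A"
    using assms(1) by (auto simp: R_splittings_def)
  have "psibar_exp (xs ! 0) \<le> (\<Sum>i\<in>A. psibar_exp (xs ! i))"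
    using A by (intro member_le_sum) (auto intro: finite_subset)
  then show ?thesis
    using assms(2) sum_list_map_nths_complement[OF A(1), of psibar_exp]
    by (simp add: R_remaining_def)
qed

lemma KM_bracket_R_splitting:
  assumes "KM_formula X" and "A \<in> R_splittings (length xs)"
  shows "KM_bracket X (R_psi_exps xs A) = KM_number (R_psi_exps xs A)"
  using assms by (auto simp: KM_formula_def R_splittings_def R_psi_exps_def length_nths_subset)

text \<open>The step from the left-hand side to the first term of (R) only trades a psibar class for a psi
  class, which is harmless: psi exponents do not enter the induction measure.\<close>

lemma twisted_reducible_to_gravitational:
  fixes X :: "'a::comm_ring_1 moduli_classes"
  assumes KM: "KM_formula X" and inv: "relabelling_invariant r X" and R: "relation_R r X"
    and d: "0 < d"
  shows "reducible rule_R (twisted r X) (\<lambda>(d', ys). d' = d \<and> gravitational (d', ys)) (Desc d xs)"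
proof (induction "total_psibar xs" arbitrary: xs rule: less_induct)
  case less
  show ?case
  proof (cases "\<exists>x \<in> set xs. 0 < psibar_exp x")
    case False
    then show ?thesis
      using d by (intro reducible_good) (auto simp: gravitational_def stable_def)
  next
    case True
    then obtain x where x: "x \<in> set xs" "0 < psibar_exp x"
      by blast
    obtain u m c where x_eq: "x = Tau u m c"
      by (cases x)
    obtain ys where perm: "mset xs = mset (x # ys)"
      using x(1) by (rule mset_move_to_front)
    define zs where "zs = Tau u m c # ys"
    define e where "e = Sum (add_mset (Desc d (Tau (u + 1) (m - 1) c # ys))
        {# Prod (Const (- KM_number (R_psi_exps zs A))) (Desc d (R_remaining zs A)).
           A \<in># mset_set (R_splittings (length zs)) #})"
    have m: "0 < m"
      using x(2) x_eq by simp
    have perm': "mset xs = mset zs"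
      using perm by (simp add: zs_def x_eq)
    have "mset (map psibar_exp xs) = mset (map psibar_exp zs)"
      using perm' by simp
    then have total: "total_psibar xs = total_psibar zs"
      by (metis sum_mset_sum_list)

    have "rewrite rule_R (Desc d xs) (Desc d zs)" "rewrite rule_R (Desc d zs) e"
      unfolding e_def
      by (intro rewrite.here rule_R.relabel rule_R.recursion perm' d m zs_def)+
    then have rew: "(rewrite rule_R)\<^sup>*\<^sup>* (Desc d xs) e"
      by auto

    have "twisted r X d xs = twisted r X d zs"
      using inv d perm' unfolding relabelling_invariant_def by blast
    also have "\<dots> = twisted r X d (Tau (u + 1) (m - 1) c # ys)
           - (\<Sum>A \<in> R_splittings (length zs).
                KM_bracket X (R_psi_exps zs A) * twisted r X d (R_remaining zs A))"
      using R d m unfolding relation_R_def zs_def Let_def by blast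
    also have "\<dots> = eval (twisted r X) e"
      unfolding e_def eval.simps(3) image_mset_add_mset sum_mset.add_mset eval.simps(2)
        eval_Sum_image_mset_set[unfolded eval.simps(3)]
      by (simp add: KM_bracket_R_splitting[OF KM] sum_negf)
    finally have val: "eval (twisted r X) (Desc d xs) = eval (twisted r X) e"
      by simp

    have "d' = d \<and> total_psibar ws < total_psibar xs" if "(d', ws) \<in> brackets e" for d' ws
      using that m finite_R_splittings total total_psibar_R_remaining[of _ zs]
      by (fastforce simp: e_def zs_def)
    then show ?thesis
      using less by (intro reducible_expand[OF rew val]) auto
  qed
qed

section \<open>Removing the psi classes\<close>

abbreviation total_psi :: "insertion list \<Rightarrow> nat" where
  "total_psi xs \<equiv> sum_list (map psi_exp xs)"

lemma finite_T_splittings: "finite (T_splittings r d n j k)"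
  by (rule finite_subset[of _ "Pow {..<n} \<times> {..d} \<times> {..r}"]) (auto simp: T_splittings_def)

text \<open>The left factor loses the psi class removed from mark $0$; the right factor does not contain
  mark $0$ at all, and the marks at the node carry no psi class. So neither factor can keep the full
  psi exponent, however the other marks are distributed.\<close>

lemma
  assumes "(A, dA, e) \<in> T_splittings r d (length xs) j k" and grav: "gravitational (d, xs)"
    and u: "1 \<le> psi_exp (xs ! 0)"
  shows gravitational_T_left: "gravitational (dA, T_left xs A e)"
    and gravitational_T_right: "gravitational (d - dA, T_right r xs A e)"
    and total_psi_T_left: "total_psi (T_left xs A e) < total_psi xs"
    and total_psi_T_right: "total_psi (T_right r xs A e) < total_psi xs"
proof -
  have A: "A \<subseteq> {..<length xs}" "0 \<in> A" and
    st: "stable dA (card A + 1)" "stable (d - dA) (length xs - card A + 1)"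
    using assms(1) by (auto simp: T_splittings_def)
  have fin: "finite A"
    using A(1) finite_subset by blast
  have A0: "A - {0} \<subseteq> {..<length xs}"
    using A by auto
  have "length (T_left xs A e) = card A + 1"
    using card_Suc_Diff1[OF fin A(2)] by (simp add: T_left_def length_nths_subset[OF A0])
  then show "gravitational (dA, T_left xs A e)"
    using st(1) grav by (auto simp: gravitational_def T_left_def dest!: in_set_nthsD)
  have "length (T_right r xs A e) = length xs - card A + 1"
    by (simp add: T_right_def length_nths_complement[OF A(1)])
  then show "gravitational (d - dA, T_right r xs A e)"
    using st(2) grav by (auto simp: gravitational_def T_right_def dest!: in_set_nthsD)
  have "sum_list (map psi_exp (nths xs (A - {0}))) = (\<Sum>i\<in>A - {0}. psi_exp (xs ! i))"
    using A0 by (simp add: sum_list_map_nths Int_absorb2)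
  moreover have "(\<Sum>i\<in>A. psi_exp (xs ! i)) = psi_exp (xs ! 0) + (\<Sum>i\<in>A - {0}. psi_exp (xs ! i))"
    using fin A(2) by (rule sum.remove)
  ultimately show "total_psi (T_left xs A e) < total_psi xs"
    and "total_psi (T_right r xs A e) < total_psi xs"
    using u sum_list_map_nths_complement[OF A(1), of psi_exp]
    by (simp_all add: T_left_def T_right_def)
qed

lemma gravitational_D_shift:
  assumes "gravitational (d, xs)"
  shows "gravitational (d, D_shift xs j)"
  using assms set_update_subset_insert[of xs j]
  by (fastforce simp: gravitational_def D_shift_def)

lemma total_psi_D_shift:
  assumes "j \<in> D_indices xs"
  shows "total_psi (D_shift xs j) < total_psi xs"
proof -
  have j: "j < length xs" "0 < psi_exp (xs ! j)"
    using assms by (auto simp: D_indices_def)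
  have "total_psi (D_shift xs j) = total_psi xs + (psi_exp (xs ! j) - 1) - psi_exp (xs ! j)"
    using j(1) by (simp add: D_shift_def map_update sum_list_update)
  then show ?thesis
    using j member_le_sum_list[of "psi_exp (xs ! j)" "map psi_exp xs"] by auto
qed

text \<open>Fewer than three marks force $d > 0$, so the division by $d$ in the solved form of (D) is
  possible exactly where it is needed.\<close>

lemma gravitational_reducible_to_gromov_witten:
  fixes X :: "'a::comm_ring_1 moduli_classes"
  assumes inv: "relabelling_invariant r X" and D: "relation_D r X" and T: "relation_T r X"
    and "gravitational (d, xs)"
  shows "reducible (rule_DT r) (twisted r X) gromov_witten (Desc d xs)"
  using \<open>gravitational (d, xs)\<close>
proof (induction "(total_psi xs, 3 - length xs)" arbitrary: d xs
    rule: wf_induct_rule[OF wf_lex_prod[OF wf_less_than wf_less_than]])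
  case 1
  then have IH: "reducible (rule_DT r) (twisted r X) gromov_witten (Desc d' ws)"
    if "gravitational (d', ws)"
      "total_psi ws < total_psi xs \<or> total_psi ws = total_psi xs \<and> 3 - length ws < 3 - length xs"
    for d' ws
    using that by auto
  note grav = \<open>gravitational (d, xs)\<close>
  consider "\<forall>x \<in> set xs. psi_exp x = 0"
    | x where "x \<in> set xs" "0 < psi_exp x" "3 \<le> length xs"
    | "length xs < 3"
    by force
  then show ?case
  proof cases
    case 1
    then show ?thesis
      using grav by (intro reducible_good) (auto simp: gromov_witten_def)
  next
    case 2
    obtain ys where perm: "mset xs = mset (x # ys)"
      using 2(1) by (rule mset_move_to_front)
    define zs where "zs = x # ys"
    have perm': "mset xs = mset zs"
      using perm by (simp add: zs_def)
    have "mset (map psi_exp xs) = mset (map psi_exp zs)"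
      using perm' by simp
    then have total: "total_psi xs = total_psi zs"
      by (metis sum_mset_sum_list)
    have len: "length zs = length xs"
      using perm' by (metis size_mset)
    have grav': "gravitational (d, zs)"
      using grav perm' len by (auto simp: gravitational_def dest: mset_eq_setD)
    (* Any two marks other than the distinguished one will do. *)
    have app: "T_applicable d zs 1 2"
      using grav' len 2 by (auto simp: T_applicable_def zs_def)
    define e where "e = Sum {# case t of (A, dA, e) \<Rightarrow>
        Prod (Desc dA (T_left zs A e)) (Desc (d - dA) (T_right r zs A e)).
        t \<in># mset_set (T_splittings r d (length zs) 1 2) #}"

    have "rewrite (rule_DT r) (Desc d xs) (Desc d zs)" "rewrite (rule_DT r) (Desc d zs) e"
      using perm' app unfolding e_def by (auto intro!: rewrite.here rule_DT.intros)
    then have rew: "(rewrite (rule_DT r))\<^sup>*\<^sup>* (Desc d xs) e"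
      by auto

    have "twisted r X d xs = twisted r X d zs"
      using inv grav perm' unfolding relabelling_invariant_def by blast
    also have "\<dots> = (\<Sum>(A, dA, e) \<in> T_splittings r d (length zs) 1 2.
             twisted r X dA (T_left zs A e) * twisted r X (d - dA) (T_right r zs A e))"
      using T app unfolding relation_T_def by blast
    also have "\<dots> = eval (twisted r X) e"
      unfolding e_def eval_Sum_image_mset_set by (intro sum.cong) auto
    finally have val: "eval (twisted r X) (Desc d xs) = eval (twisted r X) e"
      by simp

    have u: "1 \<le> psi_exp (zs ! 0)"
      using 2(2) by (simp add: zs_def)
    have "gravitational (d', ws) \<and> total_psi ws < total_psi xs" if br: "(d', ws) \<in> brackets e" for d' ws
    proof -
      obtain A dA a where t: "(A, dA, a) \<in> T_splittings r d (length zs) 1 2"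
        and ws: "(d', ws) = (dA, T_left zs A a) \<or> (d', ws) = (d - dA, T_right r zs A a)"
        using br finite_T_splittings by (auto simp: e_def)
      show ?thesis
        using ws total gravitational_T_left[OF t grav' u] gravitational_T_right[OF t grav' u]
          total_psi_T_left[OF t grav' u] total_psi_T_right[OF t grav' u] by auto
    qed
    then show ?thesis
      using IH by (intro reducible_expand[OF rew val]) auto
  next
    case 3
    have d: "0 < d"
      using grav 3 by (auto simp: gravitational_def stable_def)
    define e where "e = Prod (Const (1 / of_nat d))
        (Sum (add_mset (Desc d (xs @ [Tau 0 0 1]))
          {# Prod (Const (- 1)) (Desc d (D_shift xs j)). j \<in># mset_set (D_indices xs) #}))"
    have rew: "(rewrite (rule_DT r))\<^sup>*\<^sup>* (Desc d xs) e"
      using grav d unfolding e_def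
      by (intro r_into_rtranclp rewrite.here rule_DT.divisor_solved)
    have "eval (twisted r X) e = 1 / of_nat d *
        (twisted r X d (xs @ [Tau 0 0 1]) - (\<Sum>j \<in> D_indices xs. twisted r X d (D_shift xs j)))"
      unfolding e_def eval.simps(1,2,3,4) image_mset_add_mset sum_mset.add_mset
        eval_Sum_image_mset_set[unfolded eval.simps(3)]
      by (simp add: sum_negf)
    also have "\<dots> = twisted r X d xs"
      using D grav d unfolding relation_D_def by simp
    finally have val: "eval (twisted r X) (Desc d xs) = eval (twisted r X) e"
      by simp
    have fin: "finite (D_indices xs)"
      by (simp add: D_indices_def)
    have "gravitational (d', ws) \<and> (total_psi ws < total_psi xs \<or>
        total_psi ws = total_psi xs \<and> 3 - length ws < 3 - length xs)"
      if br: "(d', ws) \<in> brackets e" for d' ws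
    proof -
      consider "d' = d" "ws = xs @ [Tau 0 0 1]"
        | j where "j \<in> D_indices xs" "d' = d" "ws = D_shift xs j"
        using br fin by (auto simp: e_def)
      then show ?thesis
      proof cases
        case 1
        then show ?thesis
          using grav 3 by (auto simp: gravitational_def stable_def)
      next
        case 2
        then show ?thesis
          using gravitational_D_shift[OF grav] total_psi_D_shift by auto
      qed
    qed
    then show ?thesis
      using IH by (intro reducible_expand[OF rew val]) auto
  qed
qed

section \<open>Reconstruction\<close>

theorem corollary3p6:
  fixes r d :: nat and xs :: "insertion list" and X :: "'a::comm_ring_1 moduli_classes"
  assumes "KM_formula X" and "relabelling_invariant r X"
    and "relation_R r X" and "relation_D r X" and "relation_T r X"
    and "0 < d" and "0 < length xs"
  shows "\<exists>e e'.
           (rewrite rule_R)\<^sup>*\<^sup>* (Desc d xs) e \<and>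
           (\<forall>(d', ys) \<in> brackets e. d' = d \<and> gravitational (d', ys)) \<and>
           twisted r X d xs = eval (twisted r X) e \<and>
           (rewrite (rule_DT r))\<^sup>*\<^sup>* e e' \<and>
           (\<forall>b \<in> brackets e'. gromov_witten b) \<and>
           twisted r X d xs = eval (twisted r X) e'"
proof -
  obtain e where e: "(rewrite rule_R)\<^sup>*\<^sup>* (Desc d xs) e"
    "\<forall>(d', ys) \<in> brackets e. d' = d \<and> gravitational (d', ys)"
    "twisted r X d xs = eval (twisted r X) e"
    using twisted_reducible_to_gravitational[OF assms(1,2,3,6), of xs]
    unfolding reducible_def by auto
  have "reducible (rule_DT r) (twisted r X) gromov_witten e"
    using e(2) gravitational_reducible_to_gromov_witten[OF assms(2,4,5)]
    by (intro reducible_if_brackets_reducible) auto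
  then obtain e' where "(rewrite (rule_DT r))\<^sup>*\<^sup>* e e'" "\<forall>b \<in> brackets e'. gromov_witten b"
    "eval (twisted r X) e = eval (twisted r X) e'"
    unfolding reducible_def by blast
  with e show ?thesis
    by (intro exI[of _ e] exI[of _ e']) simp
qed

end
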